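(* Given an $a{:}b$-coloring of the conflict graph $G$ of the instance, Algorithm $\mathcal{C}$ is an $\frac{a}{b}$-approximation algorithm for $mRmD$ instances with the same starting location for every resource.
   Context: Problem $mRmD$ (heterogeneous multi-resource allocation with subset demand requests). An instance consists of: a finite set $D$ of demands; a finite set $R$ of resource types; for each $r\in R$ a finite set $S^r$ of starting locations and, for each $s\in S^r$, a number $l_s^r$ of resources of type $r$ starting at $s$; for each demand $d\in D$ a nonempty set $M_d\subseteq R$ of required resource types, a service start time $\tau_d\ge 0$, a service duration $\Delta_d>0$ and a reward $w_d\ge 0$; and travel times $f_{xy}\ge 0$ between any two locations ($f_{ij}$ is the travel time between the locations of demands $i$ and $j$, and $f_{sd}$ that from starting location $s$ to the location of demand $d$). All these numbers are integers. Demand $d$ requires one unit of every resource type in $M_d$ simultaneously at time $\tau_d$ for duration $\Delta_d$. A resource of type $r$ starting at $s\in S^r$ can serve $d$ as its first demand iff $r\in M_d$ and $f_{sd}\le\tau_d$; a resource of type $r$ can serve $j$ immediately after $i$ iff $r\in M_i\cap M_j$ and $\tau_i+\Delta_i+f_{ij}\le\tau_j$. A feasible solution assigns to each resource a (possibly empty) path, i.e. a sequence of demands whose first element can be served first and in which each consecutive pair can be served one immediately after the other. Demand $d$ is met if, for every $r\in M_d$, at least one resource of type $r$ has $d$ on its path. The objective is to maximize the sum of $w_d$ over met demands $d$. An $\alpha$-approximation algorithm ($\alpha\ge 1$) is an algorithm that, for every instance, returns a feasible solution with objective value at least $\frac1\alpha$ times the optimal objective value, in time polynomial in the size of the instance (the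 given coloring being part of the input). Resource types are labeled $1,\dots,|R|$ so that $m_1\le m_2\le\dots\le m_{|R|}$, where $m_r$ is the number of resources of type $r$. The conflict graph $G=(V,E)$ has one node for each distinct set among the $M_j$, $j\in D$ (nodes are identified with these subsets of $R$), and two distinct nodes $u,v$ are adjacent iff $u\cap v\ne\emptyset$. An $a{:}b$-coloring of $G$ assigns to each node a set of $b$ colors out of $a$ available colors such that adjacent nodes receive disjoint sets. For $v\in V$ let $\bar D^v=\{d\in D: M_d=v\}$, and let $1R1\bar D^v$ be the single-resource-type problem whose resources are all resources of type $i$, where $i$ is the smallest index in $v$, and whose demands are $\bar D^v$, each regarded as requiring only type $i$; it can be solved to optimality in polynomial time. Algorithm $\mathcal{C}$ (input: the instance, $G$, and an $a{:}b$-coloring of $G$ with colors $1,\dots,a$, $S_i$ being the set of nodes whose color set contains $i$): for each color $i$ and each $v\in S_i$ solve $1R1\bar D^v$ optimally, with optimal value $\mathcal{C}_v$. Choose a color $i$ maximizing $\sum_{v\in S_i}\mathcal{C}_v$ and output this value, together with the corresponding solution: for every $v\in S_i$, the demands met in the optimal solution of $1R1\bar D^v$ are served, resources of every other type in $v$ following the schedules of the resources of the smallest-index type in that solution.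
   Formalization: Travel times are additionally assumed to satisfy f_xj ≤ f_xi + Δ_i + f_ij for every location x and demands i, j (implied by the triangle inequality); for arbitrary nonnegative travel times the a/b guarantee fails. *)

theory Defs
  imports
    Complex_Main
    "HOL-Library.Log_Nat"
    "HOL-Library.Monad_Syntax"
    "HOL-Computational_Algebra.Polynomial"
begin

section \<open>Instances\<close>

text \<open>
  All numbers of an instance are nonnegative integers, hence of type \<^typ>\<open>nat\<close>. Resource types are
  labeled by natural numbers, demands and locations by elements of arbitrary types. Fields are
  only meaningful on the demands in \<open>demands\<close>, the types in \<open>types\<close>, and so on.
\<close>

record ('d, 'l) mrmd =
  demands :: "'d list"
  types :: "nat set"
  starts :: "nat \<Rightarrow> 'l set"              (* S^r *)
  stock :: "nat \<Rightarrow> 'l \<Rightarrow> nat"          (* l_s^r, first argument r *)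
  req :: "'d \<Rightarrow> nat set"                 (* M_d *)
  start_time :: "'d \<Rightarrow> nat"              (* tau_d *)
  duration :: "'d \<Rightarrow> nat"                (* Delta_d *)
  reward :: "'d \<Rightarrow> nat"                  (* w_d *)
  site :: "'d \<Rightarrow> 'l"                     (* location of d *)
  travel :: "'l \<Rightarrow> 'l \<Rightarrow> nat"            (* f_xy *)

definition valid_instance :: "('d, 'l) mrmd \<Rightarrow> bool" where
  "valid_instance I \<longleftrightarrow>
     distinct (demands I) \<and> finite (types I) \<and> (\<forall>r\<in>types I. finite (starts I r)) \<and>
     (\<forall>d\<in>set (demands I). req I d \<noteq> {} \<and> req I d \<subseteq> types I \<and> 0 < duration I d)"

text \<open>The triple \<open>(r, s, k)\<close> is the \<open>k\<close>-th resource of type \<open>r\<close> starting at \<open>s\<close>, counted from 0.\<close>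

type_synonym 'l resource = "nat \<times> 'l \<times> nat"

definition resources :: "('d, 'l) mrmd \<Rightarrow> 'l resource set" where
  "resources I = {(r, s, k). r \<in> types I \<and> s \<in> starts I r \<and> k < stock I r s}"

definition num_resources :: "('d, 'l) mrmd \<Rightarrow> nat \<Rightarrow> nat" where
  "num_resources I r = (\<Sum>s\<in>starts I r. stock I r s)"

definition can_serve_first :: "('d, 'l) mrmd \<Rightarrow> nat \<Rightarrow> 'l \<Rightarrow> 'd \<Rightarrow> bool" where
  "can_serve_first I r s d \<longleftrightarrow> r \<in> req I d \<and> travel I s (site I d) \<le> start_time I d"

definition can_serve_after :: "('d, 'l) mrmd \<Rightarrow> nat \<Rightarrow> 'd \<Rightarrow> 'd \<Rightarrow> bool" where
  "can_serve_after I r i j \<longleftrightarrow>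
     r \<in> req I i \<inter> req I j \<and>
     start_time I i + duration I i + travel I (site I i) (site I j) \<le> start_time I j"

fun valid_path :: "('d, 'l) mrmd \<Rightarrow> 'l resource \<Rightarrow> 'd list \<Rightarrow> bool" where
  "valid_path I (r, s, k) p \<longleftrightarrow>
     set p \<subseteq> set (demands I) \<and>
     (p \<noteq> [] \<longrightarrow> can_serve_first I r s (hd p)) \<and>
     successively (can_serve_after I r) p"

definition feasible :: "('d, 'l) mrmd \<Rightarrow> ('l resource \<Rightarrow> 'd list) \<Rightarrow> bool" where
  "feasible I \<sigma> \<longleftrightarrow> (\<forall>\<rho>\<in>resources I. valid_path I \<rho> (\<sigma> \<rho>))"

definition met :: "('d, 'l) mrmd \<Rightarrow> ('l resource \<Rightarrow> 'd list) \<Rightarrow> 'd \<Rightarrow> bool" where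
  "met I \<sigma> d \<longleftrightarrow> (\<forall>r\<in>req I d. \<exists>\<rho>\<in>resources I. fst \<rho> = r \<and> d \<in> set (\<sigma> \<rho>))"

definition objective :: "('d, 'l) mrmd \<Rightarrow> ('l resource \<Rightarrow> 'd list) \<Rightarrow> nat" where
  "objective I \<sigma> = (\<Sum>d\<in>{d \<in> set (demands I). met I \<sigma> d}. reward I d)"

text \<open>
  The maximum is attained: the all-empty assignment is feasible and objective values are
  bounded by the total reward.
\<close>

definition opt :: "('d, 'l) mrmd \<Rightarrow> nat" where
  "opt I = Max (objective I ` {\<sigma>. feasible I \<sigma>})"

definition same_start :: "('d, 'l) mrmd \<Rightarrow> bool" where
  "same_start I \<longleftrightarrow> (\<exists>s0. \<forall>(r, s, k)\<in>resources I. s = s0)"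

definition labeled_by_number :: "('d, 'l) mrmd \<Rightarrow> bool" where
  "labeled_by_number I \<longleftrightarrow>
     types I = {1..card (types I)} \<and>
     (\<forall>r\<in>types I. \<forall>r'\<in>types I. r \<le> r' \<longrightarrow> num_resources I r \<le> num_resources I r')"

definition locations :: "('d, 'l) mrmd \<Rightarrow> 'l set" where
  "locations I = (\<Union>r\<in>types I. starts I r) \<union> site I ` set (demands I)"

text \<open>
  Travelling directly to a demand takes no longer than travelling there via another demand that
  is served on the way. This is implicit in the meaning of travel times and follows from the
  triangle inequality (see below). Without it, dropping demands from a path can make the path
  infeasible, and the approximation guarantee fails.
\<close>

definition direct_travel :: "('d, 'l) mrmd \<Rightarrow> bool" where
  "direct_travel I \<longleftrightarrow>
     (\<forall>x\<in>locations I. \<forall>i\<in>set (demands I). \<forall>j\<in>set (demands I).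
        travel I x (site I j) \<le> travel I x (site I i) + duration I i + travel I (site I i) (site I j))"

lemma triangle_imp_direct_travel:
  assumes "\<And>x y z. \<lbrakk>x \<in> locations I; y \<in> locations I; z \<in> locations I\<rbrakk>
             \<Longrightarrow> travel I x z \<le> travel I x y + travel I y z"
  shows "direct_travel I"
  unfolding direct_travel_def
proof (intro ballI)
  fix x i j
  assume "x \<in> locations I" "i \<in> set (demands I)" "j \<in> set (demands I)"
  then have "travel I x (site I j) \<le> travel I x (site I i) + travel I (site I i) (site I j)"
    by (intro assms) (auto simp: locations_def)
  then show "travel I x (site I j)
      \<le> travel I x (site I i) + duration I i + travel I (site I i) (site I j)"
    by linarith
qed

section \<open>Conflict graph and colorings\<close>

text \<open>A graph is a pair of a node set and a set of two-element edges.\<close>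

definition conflict_graph :: "('d, 'l) mrmd \<Rightarrow> nat set set \<times> nat set set set" where
  "conflict_graph I =
     (let V = req I ` set (demands I)
      in (V, {{u, v} | u v. u \<in> V \<and> v \<in> V \<and> u \<noteq> v \<and> u \<inter> v \<noteq> {}}))"

definition ab_coloring :: "nat \<Rightarrow> nat \<Rightarrow> 'v set \<times> 'v set set \<Rightarrow> ('v \<Rightarrow> nat set) \<Rightarrow> bool" where
  "ab_coloring a b G c \<longleftrightarrow>
     (\<forall>v\<in>fst G. c v \<subseteq> {1..a} \<and> card (c v) = b) \<and>
     (\<forall>u v. {u, v} \<in> snd G \<longrightarrow> c u \<inter> c v = {})"

section \<open>Computations with running time\<close>

text \<open>
  A computation is its result together with the number of elementary steps it takes.
  \<open>charge n x\<close> delivers \<open>x\<close> after \<open>n\<close> steps. Handling a number costs its length in binary,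
  handling a type label, a demand or a location costs one step, and handling a finite
  set of type labels or colors (stored as a sorted list) costs its cardinality.
\<close>

datatype 'a timed = Timed (result: 'a) (steps: nat)

definition charge :: "nat \<Rightarrow> 'a \<Rightarrow> 'a timed" where
  "charge n x = Timed x n"

definition bind_timed :: "'a timed \<Rightarrow> ('a \<Rightarrow> 'b timed) \<Rightarrow> 'b timed" where
  "bind_timed m f = Timed (result (f (result m))) (steps m + steps (f (result m)))"

adhoc_overloading Monad_Syntax.bind \<rightleftharpoons> bind_timed

fun map_timed :: "('a \<Rightarrow> 'b timed) \<Rightarrow> 'a list \<Rightarrow> 'b list timed" where
  "map_timed f [] = charge 1 []"
| "map_timed f (x # xs) = do {
     y \<leftarrow> f x;
     ys \<leftarrow> map_timed f xs;
     charge 1 (y # ys)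
   }"

fun filter_timed :: "('a \<Rightarrow> bool timed) \<Rightarrow> 'a list \<Rightarrow> 'a list timed" where
  "filter_timed P [] = charge 1 []"
| "filter_timed P (x # xs) = do {
     keep \<leftarrow> P x;
     ys \<leftarrow> filter_timed P xs;
     charge 1 (if keep then x # ys else ys)
   }"

fun concat_timed :: "'a list list \<Rightarrow> 'a list timed" where
  "concat_timed [] = charge 1 []"
| "concat_timed (xs # xss) = do {
     ys \<leftarrow> concat_timed xss;
     charge (1 + length xs) (xs @ ys)
   }"

abbreviation bits :: "nat \<Rightarrow> nat" where
  "bits \<equiv> floorlog 2"

fun sum_timed :: "nat list \<Rightarrow> nat timed" where
  "sum_timed [] = charge 1 0"
| "sum_timed (x # xs) = do {
     y \<leftarrow> sum_timed xs;
     charge (1 + bits x + bits y) (x + y)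
   }"

text \<open>The first entry with maximal value; the empty list does not occur.\<close>

fun best_timed :: "(nat \<times> 'a list) list \<Rightarrow> (nat \<times> 'a list) timed" where
  "best_timed [] = charge 1 (0, [])"
| "best_timed [x] = charge 1 x"
| "best_timed (x # xs) = do {
     y \<leftarrow> best_timed xs;
     charge (1 + bits (fst x) + bits (fst y)) (if fst y \<le> fst x then x else y)
   }"

section \<open>Sizes, outputs and approximation algorithms\<close>

text \<open>
  Numbers are encoded in binary. In particular the number of resources may be exponential in the
  size of the instance, so a solution is output as a list of resources with their paths;
  resources that are not listed have the empty path.
\<close>

definition instance_size :: "('d, 'l) mrmd \<Rightarrow> nat" where
  "instance_size I =
     (\<Sum>d\<leftarrow>demands I. 1 + card (req I d) + bits (start_time I d) + bits (duration I d)
                       + bits (reward I d)) +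
     (\<Sum>r\<in>types I. 1 + (\<Sum>s\<in>starts I r. 1 + bits (stock I r s))) +
     (\<Sum>x\<in>locations I. \<Sum>y\<in>locations I. 1 + bits (travel I x y))"

type_synonym ('d, 'l) schedule = "('l resource \<times> 'd list) list"

definition assignment :: "('d, 'l) schedule \<Rightarrow> 'l resource \<Rightarrow> 'd list" where
  "assignment xs \<rho> = (case map_of xs \<rho> of None \<Rightarrow> [] | Some p \<Rightarrow> p)"

definition feasible_schedule :: "('d, 'l) mrmd \<Rightarrow> ('d, 'l) schedule \<Rightarrow> bool" where
  "feasible_schedule I xs \<longleftrightarrow>
     distinct (map fst xs) \<and> fst ` set xs \<subseteq> resources I \<and> feasible I (assignment xs)"

fun entry_size :: "'l resource \<times> 'd list \<Rightarrow> nat" where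
  "entry_size ((r, s, k), p) = 1 + bits k + length p"

text \<open>Algorithms output an objective value and a solution with that value.\<close>

type_synonym ('d, 'l) outcome = "nat \<times> ('d, 'l) schedule"

definition outcome_size :: "('d, 'l) outcome \<Rightarrow> nat" where
  "outcome_size out = bits (fst out) + (\<Sum>e\<leftarrow>snd out. entry_size e)"

text \<open>
  \<open>approximation_algorithm p \<alpha> X inst sz A\<close>: on the inputs in \<open>X\<close>, where input \<open>x\<close> has size \<open>sz x\<close>
  and contains the instance \<open>inst x\<close>, the algorithm \<open>A\<close> is an \<open>\<alpha>\<close>-approximation algorithm with
  running time bounded by the polynomial \<open>p\<close>. Since an algorithm needs time to write down its
  output, the size of the output is bounded as well.
\<close>

definition approximation_algorithm ::
  "nat poly \<Rightarrow> real \<Rightarrow> 'x set \<Rightarrow> ('x \<Rightarrow> ('d, 'l) mrmd) \<Rightarrow> ('x \<Rightarrow> nat)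
   \<Rightarrow> ('x \<Rightarrow> ('d, 'l) outcome timed) \<Rightarrow> bool" where
  "approximation_algorithm p \<alpha> X inst sz A \<longleftrightarrow>
     1 \<le> \<alpha> \<and>
     (\<forall>x\<in>X. case result (A x) of (value, xs) \<Rightarrow>
        feasible_schedule (inst x) xs \<and>
        value = objective (inst x) (assignment xs) \<and>
        real (objective (inst x) (assignment xs)) \<ge> 1 / \<alpha> * real (opt (inst x))) \<and>
     (\<forall>x\<in>X. steps (A x) \<le> poly p (sz x) \<and> outcome_size (result (A x)) \<le> poly p (sz x))"

definition single_type_instances :: "('d, 'l) mrmd set" where
  "single_type_instances = {I. valid_instance I \<and> card (types I) = 1}"

text \<open>An exact algorithm is a 1-approximation algorithm.\<close>

definition exact_single_type_solver :: "(('d, 'l) mrmd \<Rightarrow> ('d, 'l) outcome timed) \<Rightarrow> bool" where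
  "exact_single_type_solver solve \<longleftrightarrow>
     (\<exists>p. approximation_algorithm p 1 single_type_instances (\<lambda>I. I) instance_size solve)"

section \<open>The coloring algorithm\<close>

text \<open>
  The conflict graph is determined by the instance; the algorithm only needs its nodes as a list.
\<close>

record ('d, 'l) colored_input =
  inst :: "('d, 'l) mrmd"
  nodes :: "nat set list"
  num_colors :: nat
  color_set :: "nat set \<Rightarrow> nat set"

text \<open>The colors \<open>1, \<dots>, num_colors\<close> are listed in the input, hence \<open>num_colors\<close> counts in unary.\<close>

definition input_size :: "('d, 'l) colored_input \<Rightarrow> nat" where
  "input_size x =
     instance_size (inst x) + num_colors x +
     (\<Sum>v\<leftarrow>nodes x. 1 + card v + card (color_set x v))"

definition colored_same_start_inputs :: "nat \<Rightarrow> nat \<Rightarrow> ('d, 'l) colored_input set" where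
  "colored_same_start_inputs a b =
     {x. valid_instance (inst x) \<and> direct_travel (inst x) \<and> labeled_by_number (inst x) \<and>
         same_start (inst x) \<and>
         distinct (nodes x) \<and> set (nodes x) = fst (conflict_graph (inst x)) \<and>
         num_colors x = a \<and> ab_coloring a b (conflict_graph (inst x)) (color_set x)}"

text \<open>The problem \<open>1R1\<close> for a node \<open>v\<close>, given the list \<open>ds\<close> of demands requiring exactly \<open>v\<close>.\<close>

definition node_instance :: "('d, 'l) mrmd \<Rightarrow> nat set \<Rightarrow> 'd list \<Rightarrow> ('d, 'l) mrmd" where
  "node_instance I v ds = I\<lparr>demands := ds, types := {Min v}, req := (\<lambda>d. {Min v})\<rparr>"

definition build_node_instance :: "('d, 'l) mrmd \<Rightarrow> nat set \<Rightarrow> ('d, 'l) mrmd timed" where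
  "build_node_instance I v = do {
     ds \<leftarrow> filter_timed (\<lambda>d. charge (1 + card (req I d) + card v) (req I d = v)) (demands I);
     let J = node_instance I v ds;
     charge (card v + instance_size J) J
   }"

text \<open>Every type in \<open>v\<close> follows the given schedule of the smallest type in \<open>v\<close>.\<close>

definition copy_to_types :: "nat set \<Rightarrow> ('d, 'l) schedule \<Rightarrow> ('d, 'l) schedule timed" where
  "copy_to_types v xs = do {
     rs \<leftarrow> charge (1 + card v) (sorted_list_of_set v);
     xss \<leftarrow> map_timed (\<lambda>r. map_timed (\<lambda>((i, s, k), p).
              charge (entry_size ((i, s, k), p)) ((r, s, k), p)) xs) rs;
     concat_timed xss
   }"

definition solve_color ::
  "(('d, 'l) mrmd \<Rightarrow> ('d, 'l) outcome timed) \<Rightarrow> ('d, 'l) colored_input \<Rightarrow> nat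
   \<Rightarrow> (nat \<times> (nat set \<times> ('d, 'l) schedule) list) timed" where
  "solve_color solve x i = do {
     S \<leftarrow> filter_timed (\<lambda>v. charge (1 + card (color_set x v)) (i \<in> color_set x v)) (nodes x);
     outs \<leftarrow> map_timed (\<lambda>v. do {
               J \<leftarrow> build_node_instance (inst x) v;
               (C, xs) \<leftarrow> solve J;
               charge 1 (C, v, xs)
             }) S;
     total \<leftarrow> sum_timed (map fst outs);
     charge (1 + length outs) (total, map snd outs)
   }"

definition algorithm_C ::
  "(('d, 'l) mrmd \<Rightarrow> ('d, 'l) outcome timed) \<Rightarrow> ('d, 'l) colored_input
   \<Rightarrow> ('d, 'l) outcome timed" where
  "algorithm_C solve x = do {
     colors \<leftarrow> charge (1 + num_colors x) [1..<Suc (num_colors x)];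
     candidates \<leftarrow> map_timed (solve_color solve x) colors;
     (total, parts) \<leftarrow> best_timed candidates;
     xss \<leftarrow> map_timed (\<lambda>(v, xs). copy_to_types v xs) parts;
     ys \<leftarrow> concat_timed xss;
     charge (1 + bits total) (total, ys)
   }"

end

theory Submission
  imports Defs
begin

text \<open>
  Dropping from an optimal solution every resource but those of the smallest type \<open>Min v\<close>, and every
  demand but those with \<open>M\<^sub>d = v\<close>, gives a solution of the problem of the node \<open>v\<close> that still
  meets the demands with \<open>M\<^sub>d = v\<close> met before. Hence the optimum is at most the sum of the \<open>\<C>\<^sub>v\<close> over all
  nodes. Every node has \<open>b\<close> of the \<open>a\<close> colors, so summing the values of all color classes counts each
  \<open>\<C>\<^sub>v\<close> exactly \<open>b\<close> times, and the best class has at least the fraction \<open>b / a\<close> of the optimum.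
  Conversely, the nodes of a color class are disjoint, so their solutions use different resources, and the
  other types of a node have enough resources to copy the schedules of the smallest one.
\<close>

section \<open>Computations with running time\<close>

lemma bind_timed_simps [simp]:
  "result (bind_timed m f) = result (f (result m))"
  "steps (bind_timed m f) = steps m + steps (f (result m))"
  by (simp_all add: bind_timed_def)

lemma charge_simps [simp]:
  "result (charge n x) = x"
  "steps (charge n x) = n"
  by (simp_all add: charge_def)

lemma result_map_timed [simp]: "result (map_timed f xs) = map (\<lambda>x. result (f x)) xs"
  by (induction xs) simp_all

lemma result_filter_timed [simp]: "result (filter_timed P xs) = filter (\<lambda>x. result (P x)) xs"
  by (induction xs) simp_all

lemma result_concat_timed [simp]: "result (concat_timed xss) = concat xss"
  by (induction xss) simp_all

lemma result_sum_timed [simp]: "result (sum_timed xs) = sum_list xs"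
  by (induction xs) simp_all

lemma result_best_timed_in: "xs \<noteq> [] \<Longrightarrow> result (best_timed xs) \<in> set xs"
  by (induction xs rule: best_timed.induct) auto

lemma result_best_timed_max: "x \<in> set xs \<Longrightarrow> fst x \<le> fst (result (best_timed xs))"
  by (induction xs rule: best_timed.induct) auto

section \<open>Step counts of the list combinators and lengths of binary numbers\<close>

text \<open>Length and cost per element enter through upper bounds \<open>n\<close> and
  \<open>B\<close>, so that later both can be expressed by one number \<open>M\<close>. The extra
  step per element pays for the cons, the leading 1 for the empty list.\<close>

lemma steps_map_timed_le:
  assumes "length xs \<le> n" "\<And>x. x \<in> set xs \<Longrightarrow> steps (f x) \<le> B"
  shows "steps (map_timed f xs) \<le> 1 + n * (1 + B)"
proof -
  have "steps (map_timed f xs) \<le> 1 + length xs * (1 + B)"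
    using assms(2) by (induction xs) fastforce+
  also have "\<dots> \<le> 1 + n * (1 + B)"
    using assms(1) by (intro add_left_mono mult_le_mono) simp_all
  finally show ?thesis .
qed

lemma steps_filter_timed_le:
  assumes "length xs \<le> n" "\<And>x. x \<in> set xs \<Longrightarrow> steps (P x) \<le> B"
  shows "steps (filter_timed P xs) \<le> 1 + n * (1 + B)"
proof -
  have "steps (filter_timed P xs) \<le> 1 + length xs * (1 + B)"
    using assms(2) by (induction xs) fastforce+
  also have "\<dots> \<le> 1 + n * (1 + B)"
    using assms(1) by (intro add_left_mono mult_le_mono) simp_all
  finally show ?thesis .
qed

lemma steps_concat_timed_le:
  assumes "length xss \<le> n" "\<And>xs. xs \<in> set xss \<Longrightarrow> length xs \<le> B"
  shows "steps (concat_timed xss) \<le> 1 + n * (1 + B)"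
proof -
  have "steps (concat_timed xss) \<le> 1 + length xss * (1 + B)"
    using assms(2) by (induction xss) fastforce+
  also have "\<dots> \<le> 1 + n * (1 + B)"
    using assms(1) by (intro add_left_mono mult_le_mono) simp_all
  finally show ?thesis .
qed

lemma sum_list_map_le:
  fixes f :: "'a \<Rightarrow> nat"
  assumes "length xs \<le> n" "\<And>x. x \<in> set xs \<Longrightarrow> f x \<le> B"
  shows "(\<Sum>x\<leftarrow>xs. f x) \<le> n * B"
proof -
  have "(\<Sum>x\<leftarrow>xs. f x) \<le> length xs * B"
    using assms(2) by (induction xs) fastforce+
  also have "\<dots> \<le> n * B"
    using assms(1) by (intro mult_le_mono) simp_all
  finally show ?thesis .
qed

text \<open>The sum of the lengths is coarser than their maximum, but good enough for a polynomial
  bound.\<close>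

lemma bits_add_le: "bits (x + y) \<le> 1 + bits x + bits y"
proof -
  have less: "z < 2 ^ bits z" for z :: nat
    by (cases "z = 0") (use floorlog_bounds[of z 2] in auto)
  have "x + y < 2 ^ bits x + 2 ^ bits y"
    using less[of x] less[of y] by linarith
  \<comment> \<open>Both powers are raised to a common exponent, so that their sum is the next power
    of two.\<close>
  also have "\<dots> \<le> 2 ^ (bits x + bits y) + (2 ^ (bits x + bits y) :: nat)"
    by (intro add_mono power_increasing) auto
  finally show ?thesis
    by (intro floorlog_leI) auto
qed

text \<open>By \<open>bits_add_le\<close>, each summand lengthens the partial sum by at most
  \<open>1 + B\<close> bits.\<close>

lemma bits_sum_list_le:
  assumes "length xs \<le> n" "\<And>x. x \<in> set xs \<Longrightarrow> bits x \<le> B"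
  shows "bits (sum_list xs) \<le> n * (1 + B)"
proof -
  have "bits (sum_list xs) \<le> length xs * (1 + B)"
    using assms(2)
  proof (induction xs)
    case Nil
    then show ?case by (simp add: floorlog_def)
  next
    case (Cons x xs)
    then have "bits x \<le> B" "bits (sum_list xs) \<le> length xs * (1 + B)"
      by simp_all
    then show ?case
      using bits_add_le[of x "sum_list xs"] by simp
  qed
  also have "\<dots> \<le> n * (1 + B)"
    using assms(1) by (intro mult_le_mono) simp_all
  finally show ?thesis .
qed

lemma steps_sum_timed_le:
  assumes "length xs \<le> n" "\<And>x. x \<in> set xs \<Longrightarrow> bits x \<le> B"
  shows "steps (sum_timed xs) \<le> 1 + n * (1 + B + n * (1 + B))"
proof -
  \<comment> \<open>The inner \<open>n\<close> stays fixed during the induction while the outer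
    factor follows the list: every partial sum that is handled has at most
    \<open>n * (1 + B)\<close> bits.\<close>
  have "steps (sum_timed xs) \<le> 1 + length xs * (1 + B + n * (1 + B))"
    using assms
  proof (induction xs)
    case (Cons x xs)
    then have "bits x \<le> B" "bits (sum_list xs) \<le> n * (1 + B)"
      "steps (sum_timed xs) \<le> 1 + length xs * (1 + B + n * (1 + B))"
      using bits_sum_list_le[of xs n B] by simp_all
    then show ?case by simp
  qed simp
  also have "\<dots> \<le> 1 + n * (1 + B + n * (1 + B))"
    using assms(1) by (intro add_left_mono mult_le_mono) simp_all
  finally show ?thesis .
qed

text \<open>Comparing creates no longer numbers: the current winner is an entry of the list, hence
  at most \<open>2 * B\<close> bits per comparison.\<close>

lemma steps_best_timed_le:
  assumes "length xs \<le> n" "\<And>x. x \<in> set xs \<Longrightarrow> bits (fst x) \<le> B"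
  shows "steps (best_timed xs) \<le> 1 + n * (1 + 2 * B)"
proof -
  have "steps (best_timed xs) \<le> 1 + length xs * (1 + 2 * B)"
    using assms(2)
  proof (induction xs rule: best_timed.induct)
    case (3 x y ys)
    have "bits (fst x) \<le> B" "bits (fst (result (best_timed (y # ys)))) \<le> B"
      using 3(2) result_best_timed_in[of "y # ys"] by auto
    moreover have "steps (best_timed (y # ys)) \<le> 1 + length (y # ys) * (1 + 2 * B)"
      using 3 by simp
    ultimately show ?case by simp
  qed simp_all
  also have "\<dots> \<le> 1 + n * (1 + 2 * B)"
    using assms(1) by (intro add_left_mono mult_le_mono) simp_all
  finally show ?thesis .
qed

text \<open>Coefficients in \<open>nat\<close> are nonnegative. A bound for a smaller instance
  thereby carries over to the whole input.\<close>

lemma poly_nat_mono: "m \<le> n \<Longrightarrow> poly p m \<le> poly p n" for p :: "nat poly"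
  by (induction p) (auto intro: mult_le_mono)

section \<open>Schedules\<close>

lemma valid_path_Nil [simp]: "valid_path I \<rho> []"
  by (cases \<rho>) simp

lemma assignment_eq:
  assumes "distinct (map fst xs)" "(\<rho>, p) \<in> set xs"
  shows "assignment xs \<rho> = p"
  using assms by (simp add: assignment_def)

lemma in_assignment_iff:
  assumes "distinct (map fst xs)"
  shows "d \<in> set (assignment xs \<rho>) \<longleftrightarrow> (\<exists>p. (\<rho>, p) \<in> set xs \<and> d \<in> set p)"
  using assms by (auto simp: assignment_def split: option.splits)

text \<open>Unlisted resources have the empty path, which is always valid, so only the listed
  entries have to be checked.\<close>

lemma feasible_schedule_iff:
  "feasible_schedule I xs \<longleftrightarrow>
     distinct (map fst xs) \<and> (\<forall>(\<rho>, p)\<in>set xs. \<rho> \<in> resources I \<and> valid_path I \<rho> p)"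
proof
  assume "feasible_schedule I xs"
  then show "distinct (map fst xs) \<and> (\<forall>(\<rho>, p)\<in>set xs. \<rho> \<in> resources I \<and> valid_path I \<rho> p)"
    by (fastforce simp: feasible_schedule_def feasible_def dest: assignment_eq)
next
  assume *: "distinct (map fst xs) \<and> (\<forall>(\<rho>, p)\<in>set xs. \<rho> \<in> resources I \<and> valid_path I \<rho> p)"
  have "valid_path I \<rho> (assignment xs \<rho>)" for \<rho>
    using * by (auto simp: assignment_def split: option.splits dest!: map_of_SomeD)
  then show "feasible_schedule I xs"
    using * by (auto simp: feasible_schedule_def feasible_def)
qed

lemma met_assignment_iff:
  assumes "feasible_schedule I xs"
  shows "met I (assignment xs) d \<longleftrightarrow>
    (\<forall>r\<in>req I d. \<exists>s k p. ((r, s, k), p) \<in> set xs \<and> d \<in> set p)"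
proof -
  have "distinct (map fst xs)" and res: "\<And>\<rho> p. (\<rho>, p) \<in> set xs \<Longrightarrow> \<rho> \<in> resources I"
    using assms by (auto simp: feasible_schedule_iff)
  then have "(\<exists>\<rho>\<in>resources I. fst \<rho> = r \<and> d \<in> set (assignment xs \<rho>)) \<longleftrightarrow>
      (\<exists>\<rho> p. fst \<rho> = r \<and> (\<rho>, p) \<in> set xs \<and> d \<in> set p)" for r
    unfolding in_assignment_iff[OF \<open>distinct (map fst xs)\<close>] by blast
  then show ?thesis
    by (simp add: met_def)
qed

text \<open>There are infinitely many assignments, but their values are at most the total reward.
  This is the finiteness that \<open>Max\<close> in \<open>opt\<close> needs.\<close>

lemma finite_objectives: "finite (objective I ` A)"
proof (rule finite_subset)
  show "objective I ` A \<subseteq> {..\<Sum>d\<in>set (demands I). reward I d}"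
    by (auto simp: objective_def intro!: sum_mono2)
qed simp

lemma objective_le_opt: "feasible I \<sigma> \<Longrightarrow> objective I \<sigma> \<le> opt I"
  unfolding opt_def by (intro Max_ge finite_objectives) auto

lemma opt_attained: "\<exists>\<sigma>. feasible I \<sigma> \<and> objective I \<sigma> = opt I"
proof -
  have "feasible I (\<lambda>_. [])"
    by (simp add: feasible_def)
  then have "opt I \<in> objective I ` {\<sigma>. feasible I \<sigma>}"
    unfolding opt_def by (intro Max_in finite_objectives) auto
  then show ?thesis by auto
qed

section \<open>The single-type problem of a node\<close>

text \<open>The instance returned by \<open>build_node_instance\<close>, freed from step
  counting.\<close>

definition node_problem :: "('d, 'l) mrmd \<Rightarrow> nat set \<Rightarrow> ('d, 'l) mrmd" where
  "node_problem I v = node_instance I v (filter (\<lambda>d. req I d = v) (demands I))"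

lemma node_problem_simps [simp]:
  "demands (node_problem I v) = filter (\<lambda>d. req I d = v) (demands I)"
  "types (node_problem I v) = {Min v}"
  "starts (node_problem I v) = starts I"
  "stock (node_problem I v) = stock I"
  "req (node_problem I v) = (\<lambda>d. {Min v})"
  "start_time (node_problem I v) = start_time I"
  "duration (node_problem I v) = duration I"
  "reward (node_problem I v) = reward I"
  "site (node_problem I v) = site I"
  "travel (node_problem I v) = travel I"
  by (simp_all add: node_problem_def node_instance_def)

lemma result_build_node_instance [simp]: "result (build_node_instance I v) = node_problem I v"
  by (simp add: build_node_instance_def node_problem_def Let_def)

lemma node_types:
  assumes "valid_instance I" "v \<in> req I ` set (demands I)"
  shows "finite v" "v \<noteq> {}" "v \<subseteq> types I" "Min v \<in> v" "Min v \<in> types I"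
proof -
  show "v \<subseteq> types I" "v \<noteq> {}"
    using assms by (auto simp: valid_instance_def)
  moreover from this show "finite v"
    using assms by (auto simp: valid_instance_def intro: finite_subset)
  ultimately show "Min v \<in> v" "Min v \<in> types I"
    using Min_in[of v] by blast+
qed

lemma node_problem_single_type:
  assumes "valid_instance I" "v \<in> req I ` set (demands I)"
  shows "node_problem I v \<in> single_type_instances"
  using assms node_types[OF assms]
  by (auto simp: single_type_instances_def valid_instance_def)

section \<open>Removing demands from a path under direct travel\<close>

text \<open>The start of \<open>j\<close> leaves time for the whole detour from \<open>h\<close>
  through \<open>i\<close>, service at \<open>i\<close> included; direct travel from the site of
  \<open>h\<close> takes no longer.\<close>

lemma can_serve_after_trans:
  assumes "direct_travel I" "{h, i, j} \<subseteq> set (demands I)"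
    "can_serve_after I r h i" "can_serve_after I r i j"
  shows "can_serve_after I r h j"
proof -
  have "travel I (site I h) (site I j)
      \<le> travel I (site I h) (site I i) + duration I i + travel I (site I i) (site I j)"
    using assms(1,2) unfolding direct_travel_def by (auto simp: locations_def)
  then show ?thesis
    using assms(3,4) by (auto simp: can_serve_after_def)
qed

lemma can_serve_first_trans:
  assumes "direct_travel I" "{i, j} \<subseteq> set (demands I)" "s \<in> locations I"
    "can_serve_first I r s i" "can_serve_after I r i j"
  shows "can_serve_first I r s j"
proof -
  have "travel I s (site I j) \<le> travel I s (site I i) + duration I i + travel I (site I i) (site I j)"
    using assms(1-3) unfolding direct_travel_def by auto
  then show ?thesis
    using assms(4,5) by (auto simp: can_serve_first_def can_serve_after_def)
qed

text \<open>
  Direct travel makes \<open>can_serve_after\<close> transitive, so that a path is sorted rather than merely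
  linked; sortedness survives the removal of demands.
\<close>

lemma valid_path_filter:
  assumes dt: "direct_travel I" and s: "s \<in> locations I" and p: "valid_path I (r, s, k) p"
  shows "valid_path I (r, s, k) (filter P p)"
proof -
  \<comment> \<open>Transitivity is available only among demands of the instance, so membership is
    made part of the relation.\<close>
  define R where "R i j \<longleftrightarrow> {i, j} \<subseteq> set (demands I) \<and> can_serve_after I r i j" for i j
  have D: "set p \<subseteq> set (demands I)"
    using p by simp
  have "transp R"
    by (rule transpI) (auto simp: R_def intro: can_serve_after_trans[OF dt])
  moreover have "successively R p"
    using p D by (auto simp: R_def intro: successively_mono[of "can_serve_after I r"])
  ultimately have sorted: "sorted_wrt R p"
    by (simp add: successively_conv_sorted_wrt)
  \<comment> \<open>Whatever demand comes first after filtering, it could have been served first: it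
    is the old head or comes after it.\<close>
  have first: "can_serve_first I r s d" if "d \<in> set p" for d
  proof (cases p)
    case (Cons i q)
    with p sorted that can_serve_first_trans[OF dt _ s, of i d] show ?thesis
      by (auto simp: R_def)
  qed (use that in simp)
  have "successively R (filter P p)"
    using \<open>transp R\<close> sorted by (simp add: successively_conv_sorted_wrt sorted_wrt_filter)
  then have "successively (can_serve_after I r) (filter P p)"
    by (rule successively_mono) (auto simp: R_def)
  moreover have "can_serve_first I r s (hd (filter P p))" if "filter P p \<noteq> []"
    using hd_in_set[OF that] by (auto intro: first)
  ultimately show ?thesis
    using D by auto
qed

lemma opt_node_problem_ge:
  assumes valid: "valid_instance I" and dt: "direct_travel I"
    and v: "v \<in> req I ` set (demands I)" and \<sigma>: "feasible I \<sigma>"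
  shows "(\<Sum>d | d \<in> {d \<in> set (demands I). met I \<sigma> d} \<and> req I d = v. reward I d)
    \<le> opt (node_problem I v)"
proof -
  let ?J = "node_problem I v"
  \<comment> \<open>Only demands are filtered here. The other types drop out because
    \<open>resources ?J\<close> contains type \<open>Min v\<close> only.\<close>
  define \<sigma>' where "\<sigma>' \<rho> = filter (\<lambda>d. req I d = v) (\<sigma> \<rho>)" for \<rho>
  note node = node_types[OF valid v]
  have res: "(r, s, k) \<in> resources ?J \<longleftrightarrow> (r, s, k) \<in> resources I \<and> r = Min v" for r s k
    using node by (auto simp: resources_def)
  have "valid_path ?J (r, s, k) (\<sigma>' (r, s, k))" if "(r, s, k) \<in> resources ?J" for r s k
  proof -
    have "s \<in> locations I"
      using that node by (auto simp: resources_def locations_def)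
    moreover have "valid_path I (r, s, k) (\<sigma> (r, s, k))"
      using \<sigma> that unfolding feasible_def res by blast
    ultimately have path: "valid_path I (r, s, k) (\<sigma>' (r, s, k))"
      unfolding \<sigma>'_def by (intro valid_path_filter dt)
    then have "set (\<sigma>' (r, s, k)) \<subseteq> set (demands ?J)"
      by (auto simp: \<sigma>'_def)
    moreover have "r = Min v"
      using that by (simp add: res)
    moreover have "successively (can_serve_after ?J r) (\<sigma>' (r, s, k))"
      by (rule successively_mono[of "can_serve_after I r"])
        (use path \<open>r = Min v\<close> in \<open>auto simp: can_serve_after_def\<close>)
    ultimately show ?thesis
      using path by (auto simp: can_serve_first_def)
  qed
  then have "feasible ?J \<sigma>'"
    by (auto simp: feasible_def)
  moreover have "met ?J \<sigma>' d" if d: "met I \<sigma> d" "req I d = v" for d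
  proof -
    \<comment> \<open>A demand met in \<open>I\<close> has a resource of every type in
      \<open>v\<close>; the one of type \<open>Min v\<close> is all that \<open>?J\<close> asks
      for.\<close>
    obtain \<rho> where "\<rho> \<in> resources I" "fst \<rho> = Min v" "d \<in> set (\<sigma> \<rho>)"
      using d node(4) unfolding met_def by blast
    then obtain s k where "(Min v, s, k) \<in> resources I" "d \<in> set (\<sigma> (Min v, s, k))"
      by (cases \<rho>) auto
    moreover from this have "(Min v, s, k) \<in> resources ?J"
      by (simp add: res)
    ultimately show ?thesis
      using d(2) unfolding met_def by (auto simp: \<sigma>'_def intro!: bexI[of _ "(Min v, s, k)"])
  qed
  then have "(\<Sum>d | d \<in> {d \<in> set (demands I). met I \<sigma> d} \<and> req I d = v. reward I d)
      \<le> objective ?J \<sigma>'"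
    unfolding objective_def by (auto intro!: sum_mono2)
  ultimately show ?thesis
    using objective_le_opt[of ?J \<sigma>'] by linarith
qed

lemma opt_le_sum_opt_nodes:
  assumes "valid_instance I" "direct_travel I"
  shows "opt I \<le> (\<Sum>v\<in>req I ` set (demands I). opt (node_problem I v))"
proof -
  obtain \<sigma> where \<sigma>: "feasible I \<sigma>" "objective I \<sigma> = opt I"
    using opt_attained by blast
  \<comment> \<open>Each met demand is counted at exactly one node, its own requirement set.\<close>
  have "opt I = (\<Sum>v\<in>req I ` set (demands I).
      \<Sum>d | d \<in> {d \<in> set (demands I). met I \<sigma> d} \<and> req I d = v. reward I d)"
    unfolding \<sigma>(2)[symmetric] objective_def by (rule sum.group[symmetric]) auto
  also have "\<dots> \<le> (\<Sum>v\<in>req I ` set (demands I). opt (node_problem I v))"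
    using assms \<sigma>(1) by (intro sum_mono opt_node_problem_ge) auto
  finally show ?thesis .
qed

section \<open>Combining the schedules of disjoint nodes\<close>

text \<open>The result of \<open>copy_to_types\<close> without the step count. For a node
  \<open>v\<close>, one of the copies is for \<open>Min v\<close> itself and returns the given
  schedule.\<close>

definition copies :: "nat set \<Rightarrow> ('d, 'l) schedule \<Rightarrow> ('d, 'l) schedule" where
  "copies v xs = concat (map (\<lambda>r. map (\<lambda>((i, s, k), p). ((r, s, k), p)) xs) (sorted_list_of_set v))"

lemma result_copy_to_types [simp]: "result (copy_to_types v xs) = copies v xs"
  by (simp add: copy_to_types_def copies_def case_prod_unfold)

lemma set_copies:
  "finite v \<Longrightarrow> ((r, s, k), p) \<in> set (copies v xs) \<longleftrightarrow> r \<in> v \<and> (\<exists>i. ((i, s, k), p) \<in> set xs)"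
  by (force simp: copies_def)

text \<open>Disjointness is asked for distinct indices, not for distinct blocks, so that several
  blocks may be empty.\<close>

lemma distinct_concat_map:
  assumes "distinct xs" "\<And>x. x \<in> set xs \<Longrightarrow> distinct (f x)"
    "\<And>x y. \<lbrakk>x \<in> set xs; y \<in> set xs; x \<noteq> y\<rbrakk> \<Longrightarrow> set (f x) \<inter> set (f y) = {}"
  shows "distinct (concat (map f xs))"
  using assms
proof (induction xs)
  case (Cons x xs)
  have "set (f x) \<inter> set (f y) = {}" if "y \<in> set xs" for y
    using Cons.prems(1) that by (intro Cons.prems(3)) auto
  then show ?case
    using Cons by auto
qed simp

text \<open>Within one block relabeling is injective because all entries carry the same label
  \<open>m\<close>; different blocks differ in the new label.\<close>

lemma distinct_copies:
  assumes "distinct (map fst xs)" "\<And>i s k p. ((i, s, k), p) \<in> set xs \<Longrightarrow> i = m"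
  shows "distinct (map fst (copies v xs))"
proof -
  have keys: "map fst (copies v xs) =
      concat (map (\<lambda>r. map (\<lambda>(i, s, k). (r, s, k)) (map fst xs)) (sorted_list_of_set v))"
    by (simp add: copies_def map_concat comp_def case_prod_unfold)
  have "fst ` set xs \<subseteq> {m} \<times> UNIV"
    using assms(2) by auto
  moreover have "inj_on (\<lambda>(i, s, k). (r, s, k)) ({m} \<times> UNIV)" for r :: nat
    by (auto simp: inj_on_def)
  ultimately have "inj_on (\<lambda>(i, s, k). (r, s, k)) (fst ` set xs)" for r :: nat
    by (blast intro: inj_on_subset)
  then have "distinct (map (\<lambda>(i, s, k). (r, s, k)) (map fst xs))" for r :: nat
    using assms(1) by (subst distinct_map) simp
  then show ?thesis
    unfolding keys by (intro distinct_concat_map) auto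
qed

text \<open>
  With a common starting location, the number of resources of a type is the stock there, so a type
  with more resources has every (location, counter) pair that the smallest type uses.
\<close>

lemma num_resources_same_start:
  assumes "\<And>r s k. (r, s, k) \<in> resources I \<Longrightarrow> s = s0" "r \<in> types I" "finite (starts I r)"
  shows "num_resources I r = (if s0 \<in> starts I r then stock I r s0 else 0)"
proof -
  \<comment> \<open>Any stock at another location would yield a resource number 0 starting
    there.\<close>
  have "stock I r s = 0" if "s \<in> starts I r" "s \<noteq> s0" for s
    using assms(1)[of r s 0] assms(2) that by (auto simp: resources_def)
  then have "num_resources I r = (\<Sum>s\<in>starts I r. if s = s0 then stock I r s0 else 0)"
    unfolding num_resources_def by (intro sum.cong) auto
  then show ?thesis
    using assms(3) by simp
qed

lemma resources_mono:
  assumes "valid_instance I" "labeled_by_number I" "same_start I"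
    "(r, s, k) \<in> resources I" "r' \<in> types I" "r \<le> r'"
  shows "(r', s, k) \<in> resources I"
proof -
  obtain s0 where s0: "\<And>r s k. (r, s, k) \<in> resources I \<Longrightarrow> s = s0"
    using assms(3) by (fastforce simp: same_start_def)
  have r: "r \<in> types I" "s = s0" "s0 \<in> starts I r" "k < stock I r s0"
    using assms(4) s0 by (auto simp: resources_def)
  have fin: "finite (starts I r)" "finite (starts I r')"
    using assms(1,5) r(1) by (auto simp: valid_instance_def)
  have "num_resources I r \<le> num_resources I r'"
    using assms(2,5,6) r(1) by (auto simp: labeled_by_number_def)
  \<comment> \<open>The default 0 cannot occur: the left side exceeds \<open>k\<close>, so
    \<open>s0\<close> is a starting location of \<open>r'\<close> too.\<close>
  then have "stock I r s0 \<le> (if s0 \<in> starts I r' then stock I r' s0 else 0)"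
    using num_resources_same_start[OF s0 r(1) fin(1)] num_resources_same_start[OF s0 assms(5) fin(2)]
      r(3) by simp
  then show ?thesis
    using r assms(5) by (auto simp: resources_def split: if_splits)
qed

text \<open>Copies for different nodes never share a type, and a demand on a path of node
  \<open>v\<close> requires exactly \<open>v\<close>. So no demand is met by mixing schedules of
  several nodes, which makes the value equal to the sum and not merely at least as large.\<close>

lemma combined_schedule:
  assumes I: "valid_instance I" "labeled_by_number I" "same_start I"
    and S: "distinct S" "set S \<subseteq> req I ` set (demands I)"
    and disj: "\<And>u v. \<lbrakk>u \<in> set S; v \<in> set S; u \<noteq> v\<rbrakk> \<Longrightarrow> u \<inter> v = {}"
    and feas: "\<And>v. v \<in> set S \<Longrightarrow> feasible_schedule (node_problem I v) (xs v)"
  defines "ys \<equiv> concat (map (\<lambda>v. copies v (xs v)) S)"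
  shows "feasible_schedule I ys"
    and "objective I (assignment ys)
      = (\<Sum>v\<leftarrow>S. objective (node_problem I v) (assignment (xs v)))"
proof -
  have node: "finite v" "v \<noteq> {}" "v \<subseteq> types I" "Min v \<in> v" if "v \<in> set S" for v
    using node_types[OF I(1) subsetD[OF S(2) that]] by blast+
  have in_xs: "i = Min v" "(Min v, s, k) \<in> resources I" "valid_path (node_problem I v) (i, s, k) p"
    if "v \<in> set S" "((i, s, k), p) \<in> set (xs v)" for v i s k p
  proof -
    have *: "(i, s, k) \<in> resources (node_problem I v) \<and> valid_path (node_problem I v) (i, s, k) p"
      using feas[OF that(1)] that(2) unfolding feasible_schedule_iff by blast
    then show "valid_path (node_problem I v) (i, s, k) p" "i = Min v"
      by (auto simp: resources_def simp del: valid_path.simps)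
    then show "(Min v, s, k) \<in> resources I"
      using * node(3,4)[OF that(1)] by (auto simp: resources_def)
  qed
  have in_ys: "((r, s, k), p) \<in> set ys \<longleftrightarrow> (\<exists>v\<in>set S. r \<in> v \<and> ((Min v, s, k), p) \<in> set (xs v))"
    for r s k p
  proof -
    have "(\<exists>i. ((i, s, k), p) \<in> set (xs v)) \<longleftrightarrow> ((Min v, s, k), p) \<in> set (xs v)"
      if "v \<in> set S" for v
      using in_xs(1)[OF that] by metis
    then show ?thesis
      by (auto simp: ys_def set_copies node(1))
  qed

  have "distinct (map fst ys)"
  proof -
    have "distinct (map fst (copies v (xs v)))" if "v \<in> set S" for v
      using feas[OF that] in_xs(1)[OF that]
      by (intro distinct_copies[of _ "Min v"]) (auto simp: feasible_schedule_iff)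
    moreover have "set (map fst (copies u (xs u))) \<inter> set (map fst (copies v (xs v))) = {}"
      if "u \<in> set S" "v \<in> set S" "u \<noteq> v" for u v
      using disj[OF that] by (auto simp: set_copies node(1) that)
    ultimately show ?thesis
      unfolding ys_def map_concat map_map comp_def
      using S(1) by (intro distinct_concat_map) auto
  qed
  moreover have "(r, s, k) \<in> resources I \<and> valid_path I (r, s, k) p"
    if "((r, s, k), p) \<in> set ys" for r s k p
  proof -
    obtain v where v: "v \<in> set S" "r \<in> v" "((Min v, s, k), p) \<in> set (xs v)"
      using \<open>((r, s, k), p) \<in> set ys\<close> by (auto simp: in_ys)
    have "(r, s, k) \<in> resources I"
      \<comment> \<open>The resource exists for \<open>Min v\<close>, and
        \<open>Min v \<le> r\<close> because \<open>r\<close> is in \<open>v\<close>.\<close>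
      by (rule resources_mono[OF I in_xs(2)[OF v(1,3)]]) (use node[OF v(1)] v(2) in auto)
    moreover have path: "valid_path (node_problem I v) (Min v, s, k) p"
      using in_xs(3)[OF v(1,3)] .
    then have p: "set p \<subseteq> set (demands I)" "\<And>d. d \<in> set p \<Longrightarrow> req I d = v"
      by auto
    \<comment> \<open>Changing the type leaves the time conditions alone; all demands on the path
      require \<open>v\<close>, which contains \<open>r\<close>.\<close>
    moreover have "successively (can_serve_after I r) p"
      by (rule successively_mono[of "can_serve_after (node_problem I v) (Min v)"])
        (use path p v(2) in \<open>auto simp: can_serve_after_def\<close>)
    ultimately show ?thesis
      using path v(2) by (auto simp: can_serve_first_def)
  qed
  ultimately show feas_ys: "feasible_schedule I ys"
    by (auto simp: feasible_schedule_iff)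

  have met: "met I (assignment ys) d
      \<longleftrightarrow> req I d \<in> set S \<and> met (node_problem I (req I d)) (assignment (xs (req I d))) d"
    if d: "d \<in> set (demands I)" for d
  proof -
    define served where "served v \<longleftrightarrow> (\<exists>s k p. ((Min v, s, k), p) \<in> set (xs v) \<and> d \<in> set p)" for v
    \<comment> \<open>Only the schedule of its own requirement set can serve \<open>d\<close>. This
      collapses the choice of a \<open>v\<close> for every \<open>r\<close> to the single candidate
      \<open>req I d\<close>.\<close>
    have req: "req I d = v" if v: "v \<in> set S" "served v" for v
    proof -
      obtain s k p where "((Min v, s, k), p) \<in> set (xs v)" "d \<in> set p"
        using v(2) unfolding served_def by blast
      then show ?thesis
        using in_xs(3)[OF v(1)] by fastforce
    qed
    \<comment> \<open>Otherwise \<open>d\<close> would be met vacuously, without its node being in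
      \<open>S\<close>.\<close>
    have "req I d \<noteq> {}"
      using I(1) d by (auto simp: valid_instance_def)
    moreover have "met I (assignment ys) d \<longleftrightarrow> (\<forall>r\<in>req I d. \<exists>v\<in>set S. r \<in> v \<and> served v)"
      unfolding met_assignment_iff[OF feas_ys] in_ys served_def
      by (intro ball_cong refl) blast
    ultimately have "met I (assignment ys) d \<longleftrightarrow> req I d \<in> set S \<and> served (req I d)"
      using req by (metis all_not_in_conv)
    then show ?thesis
      by (simp add: met_assignment_iff[OF feas] served_def cong: conj_cong)
  qed
  have "objective I (assignment ys) =
      (\<Sum>v\<in>set S. \<Sum>d | d \<in> {d \<in> set (demands I). met I (assignment ys) d} \<and> req I d = v. reward I d)"
    unfolding objective_def by (rule sum.group[symmetric]) (auto simp: met)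
  also have "\<dots> = (\<Sum>v\<in>set S. objective (node_problem I v) (assignment (xs v)))"
    unfolding objective_def by (intro sum.cong) (auto simp: met)
  finally show "objective I (assignment ys)
      = (\<Sum>v\<leftarrow>S. objective (node_problem I v) (assignment (xs v)))"
    using S(1) by (simp add: sum_list_distinct_conv_sum_set)
qed

section \<open>Sizes\<close>

lemma length_demands_le: "length (demands I) \<le> instance_size I"
proof -
  have "length (demands I) = (\<Sum>d\<leftarrow>demands I. 1)"
    by (simp add: sum_list_triv)
  also have "\<dots> \<le> (\<Sum>d\<leftarrow>demands I. 1 + card (req I d) + bits (start_time I d)
      + bits (duration I d) + bits (reward I d))"
    by (intro sum_list_mono) simp
  finally show ?thesis
    unfolding instance_size_def by linarith
qed

lemma card_req_le:
  assumes "d \<in> set (demands I)"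
  shows "card (req I d) \<le> instance_size I"
proof -
  have "1 + card (req I d) + bits (start_time I d) + bits (duration I d) + bits (reward I d)
      \<le> (\<Sum>d\<leftarrow>demands I. 1 + card (req I d) + bits (start_time I d)
        + bits (duration I d) + bits (reward I d))"
    using assms by (intro member_le_sum_list) auto
  then show ?thesis
    unfolding instance_size_def by linarith
qed

text \<open>A nonempty requirement set shrinks to one type, a single summand of the types remains,
  and the set of locations can only become smaller.\<close>

lemma instance_size_node_problem_le:
  assumes "valid_instance I" "v \<in> req I ` set (demands I)"
  shows "instance_size (node_problem I v) \<le> instance_size I"
proof -
  let ?w = "\<lambda>d. bits (start_time I d) + bits (duration I d) + bits (reward I d)"
  let ?t = "\<lambda>r. 1 + (\<Sum>s\<in>starts I r. 1 + bits (stock I r s))"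
  \<comment> \<open>The second 1 is the size of the new requirement set
    \<open>{Min v}\<close>.\<close>
  have "1 + 1 + ?w d \<le> 1 + card (req I d) + ?w d" if "d \<in> set (demands I)" for d
    using node_types[OF assms(1) imageI[OF that]] by (simp add: Suc_le_eq card_gt_0_iff)
  then have "(\<Sum>d\<leftarrow>filter (\<lambda>d. req I d = v) (demands I). 1 + 1 + ?w d)
      \<le> (\<Sum>d\<leftarrow>filter (\<lambda>d. req I d = v) (demands I). 1 + card (req I d) + ?w d)"
    by (intro sum_list_mono) auto
  also have "\<dots> \<le> (\<Sum>d\<leftarrow>demands I. 1 + card (req I d) + ?w d)"
    by (rule sum_list_filter_le_nat)
  finally have demands: "(\<Sum>d\<leftarrow>filter (\<lambda>d. req I d = v) (demands I). 1 + 1 + ?w d)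
      \<le> (\<Sum>d\<leftarrow>demands I. 1 + card (req I d) + ?w d)" .
  have types: "?t (Min v) \<le> (\<Sum>r\<in>types I. ?t r)"
    using assms(1) node_types(5)[OF assms]
    by (intro member_le_sum) (auto simp: valid_instance_def)
  have "locations (node_problem I v) \<subseteq> locations I" "finite (locations I)"
    using assms(1) node_types(5)[OF assms] by (auto simp: locations_def valid_instance_def)
  then have "(\<Sum>x\<in>locations (node_problem I v). \<Sum>y\<in>locations (node_problem I v). 1 + bits (travel I x y))
      \<le> (\<Sum>x\<in>locations I. \<Sum>y\<in>locations I. 1 + bits (travel I x y))"
    by (intro order_trans[OF sum_mono sum_mono2]) (auto intro!: sum_mono2 intro: finite_subset)
  with demands types show ?thesis
    by (simp add: instance_size_def add.assoc)
qed

lemma entry_size_conv: "entry_size e = 1 + bits (snd (snd (fst e))) + length (snd e)"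
  by (cases e rule: entry_size.cases) simp

lemma entries_le_outcome_size:
  "length (snd out) \<le> outcome_size out" "e \<in> set (snd out) \<Longrightarrow> entry_size e \<le> outcome_size out"
proof -
  have "1 \<le> entry_size e" for e :: "'l resource \<times> 'd list"
    by (simp add: entry_size_conv)
  then have "(\<Sum>e\<leftarrow>snd out. 1) \<le> (\<Sum>e\<leftarrow>snd out. entry_size e)"
    by (intro sum_list_mono)
  then show "length (snd out) \<le> outcome_size out"
    by (simp add: outcome_size_def sum_list_triv)
  assume "e \<in> set (snd out)"
  then have "entry_size e \<le> (\<Sum>e\<leftarrow>snd out. entry_size e)"
    by (intro member_le_sum_list) auto
  then show "entry_size e \<le> outcome_size out"
    by (simp add: outcome_size_def)
qed

text \<open>
  The bounds are defined over any semiring so that they can be read both as numbers and as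
  polynomials; evaluation of polynomials commutes with them.
\<close>

definition build_bound :: "'a::comm_semiring_1 \<Rightarrow> 'a" where
  "build_bound M = 1 + M * (1 + (1 + M + M)) + (M + M)"

definition color_bound :: "'a::comm_semiring_1 \<Rightarrow> 'a" where
  "color_bound M = (1 + M * (1 + (1 + M))) + (1 + M * (1 + (build_bound M + M + 1)))
     + (1 + M * (1 + M + M * (1 + M))) + (1 + M)"

definition copy_bound :: "'a::comm_semiring_1 \<Rightarrow> 'a" where
  "copy_bound M = (1 + M) + (1 + M * (1 + (1 + M * (1 + M)))) + (1 + M * (1 + M))"

text \<open>The summands follow \<open>algorithm_C\<close> in order; the last one,
  \<open>M * (M * M)\<close>, accounts for the size of the output schedule.\<close>

definition total_bound :: "'a::comm_semiring_1 \<Rightarrow> 'a" where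
  "total_bound M = (1 + M) + (1 + M * (1 + color_bound M)) + (1 + M * (1 + 2 * (M * (1 + M))))
     + (1 + M * (1 + copy_bound M)) + (1 + M * (1 + M * M)) + (1 + M * (1 + M)) + M * (M * M)"

lemma poly_total_bound: "poly (total_bound p) n = total_bound (poly p n)"
  by (simp add: total_bound_def copy_bound_def color_bound_def build_bound_def)

lemma steps_build_node_instance_le:
  assumes "valid_instance I" "v \<in> req I ` set (demands I)" "instance_size I \<le> M"
  shows "steps (build_node_instance I v) \<le> build_bound M"
proof -
  have "card v \<le> M"
    using assms(2,3) card_req_le[of _ I] by fastforce
  moreover have "steps (filter_timed (\<lambda>d. charge (1 + card (req I d) + card v) (req I d = v)) (demands I))
      \<le> 1 + M * (1 + (1 + M + M))"
    using assms(3) length_demands_le[of I] card_req_le[of _ I] \<open>card v \<le> M\<close>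
    by (intro steps_filter_timed_le) (force intro: add_mono)+
  moreover have "instance_size (node_problem I v) \<le> M"
    using instance_size_node_problem_le[OF assms(1,2)] assms(3) by linarith
  ultimately show ?thesis
    unfolding build_node_instance_def build_bound_def
    by (simp add: Let_def node_problem_def)
qed

lemma length_copies: "length (copies v xs) = card v * length xs"
  by (simp add: copies_def length_concat comp_def sum_list_triv)

lemma sum_list_map_concat: "(\<Sum>x\<leftarrow>concat xss. f x) = (\<Sum>xs\<leftarrow>xss. \<Sum>x\<leftarrow>xs. f x)"
  for f :: "'a \<Rightarrow> nat"
  by (induction xss) simp_all

text \<open>\<open>entry_size\<close> does not depend on the type label, so every copy is as large
  as the original.\<close>

lemma sum_entry_size_copies:
  "(\<Sum>e\<leftarrow>copies v xs. entry_size e) = card v * (\<Sum>e\<leftarrow>xs. entry_size e)"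
  by (simp add: copies_def sum_list_map_concat comp_def case_prod_unfold sum_list_triv
      entry_size_conv)

lemma steps_copy_to_types_le:
  assumes "card v \<le> M" "length xs \<le> M" "\<And>e. e \<in> set xs \<Longrightarrow> entry_size e \<le> M"
  shows "steps (copy_to_types v xs) \<le> copy_bound M"
proof -
  have copy: "steps (map_timed (\<lambda>((i, s, k), p). charge (entry_size ((i, s, k), p)) ((r, s, k), p)) xs)
      \<le> 1 + M * (1 + M)" for r :: nat
    using assms(2,3) by (intro steps_map_timed_le) auto
  let ?copies = "map_timed (\<lambda>r. map_timed (\<lambda>((i, s, k), p).
    charge (entry_size ((i, s, k), p)) ((r, s, k), p)) xs) (sorted_list_of_set v)"
  have "steps ?copies \<le> 1 + M * (1 + (1 + M * (1 + M)))"
    using assms(1) copy by (intro steps_map_timed_le[of "sorted_list_of_set v"]) simp_all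
  moreover have "steps (concat_timed (result ?copies)) \<le> 1 + M * (1 + M)"
    using assms(1,2) by (intro steps_concat_timed_le) auto
  ultimately show ?thesis
    using assms(1) unfolding copy_to_types_def copy_bound_def bind_timed_simps charge_simps
    by linarith
qed

section \<open>The coloring algorithm\<close>

locale coloring_run =
  fixes solve :: "('d, 'l) mrmd \<Rightarrow> ('d, 'l) outcome timed"
    and q :: "nat poly" and x :: "('d, 'l) colored_input" and a b :: nat
  assumes solver: "approximation_algorithm q 1 single_type_instances (\<lambda>I. I) instance_size solve"
    and input: "x \<in> colored_same_start_inputs a b"
    and b_pos: "0 < b" and b_le: "b \<le> a"
begin

abbreviation V :: "nat set set" where
  "V \<equiv> req (inst x) ` set (demands (inst x))"

text \<open>\<open>fst (out v)\<close> is the number \<open>C_v\<close> of the algorithm;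
  \<open>color_class i\<close> below is \<open>S_i\<close> as a list.\<close>

definition out :: "nat set \<Rightarrow> ('d, 'l) outcome" where
  "out v = result (solve (node_problem (inst x) v))"

definition color_class :: "nat \<Rightarrow> nat set list" where
  "color_class i = filter (\<lambda>v. i \<in> color_set x v) (nodes x)"

definition color_value :: "nat \<Rightarrow> nat" where
  "color_value i = (\<Sum>v\<leftarrow>color_class i. fst (out v))"

lemma instance_props:
  "valid_instance (inst x)" "direct_travel (inst x)" "labeled_by_number (inst x)" "same_start (inst x)"
  "distinct (nodes x)" "set (nodes x) = V" "num_colors x = a"
  using input by (auto simp: colored_same_start_inputs_def conflict_graph_def Let_def)

lemma color_set_props: "v \<in> V \<Longrightarrow> color_set x v \<subseteq> {1..a} \<and> card (color_set x v) = b"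
  using input
  by (auto simp: colored_same_start_inputs_def conflict_graph_def Let_def ab_coloring_def)

lemma same_color_disjoint:
  assumes "u \<in> V" "v \<in> V" "u \<noteq> v" "i \<in> color_set x u" "i \<in> color_set x v"
  shows "u \<inter> v = {}"
proof (rule ccontr)
  assume "u \<inter> v \<noteq> {}"
  with assms(1-3) have "{u, v} \<in> snd (conflict_graph (inst x))"
    unfolding conflict_graph_def Let_def by auto
  then have "color_set x u \<inter> color_set x v = {}"
    using input by (auto simp: colored_same_start_inputs_def ab_coloring_def)
  then show False
    using assms(4,5) by blast
qed

lemma out_props:
  assumes "v \<in> V"
  shows "feasible_schedule (node_problem (inst x) v) (snd (out v))"
    and "fst (out v) = objective (node_problem (inst x) v) (assignment (snd (out v)))"
    and "opt (node_problem (inst x) v) \<le> fst (out v)"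
  using solver node_problem_single_type[OF instance_props(1) assms]
  by (auto simp: approximation_algorithm_def out_def case_prod_unfold)

lemma set_color_class: "set (color_class i) = {v \<in> V. i \<in> color_set x v}"
  by (auto simp: color_class_def instance_props)

lemma distinct_color_class: "distinct (color_class i)"
  by (simp add: color_class_def instance_props)

lemma result_solve_color:
  "result (solve_color solve x i) = (color_value i, map (\<lambda>v. (v, snd (out v))) (color_class i))"
  by (simp add: solve_color_def color_value_def color_class_def out_def case_prod_unfold comp_def)

text \<open>\<open>i\<close> is the chosen color. The intermediate result of
  \<open>best_timed\<close> is kept for counting the steps of the later stages.\<close>

lemma result_algorithm_C:
  obtains i where "i \<in> {1..a}" "\<And>j. j \<in> {1..a} \<Longrightarrow> color_value j \<le> color_value i"
    "result (algorithm_C solve x)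
      = (color_value i, concat (map (\<lambda>v. copies v (snd (out v))) (color_class i)))"
    "result (best_timed (map (\<lambda>i. result (solve_color solve x i)) [1..<Suc a]))
      = (color_value i, map (\<lambda>v. (v, snd (out v))) (color_class i))"
proof -
  let ?cs = "map (\<lambda>i. result (solve_color solve x i)) [1..<Suc a]"
  \<comment> \<open>Since \<open>0 < b\<close> and \<open>b \<le> a\<close> there is a color, so the
    default value of \<open>best_timed []\<close> does not arise.\<close>
  have "?cs \<noteq> []"
    using b_pos b_le by simp
  then have "result (best_timed ?cs) \<in> set ?cs"
    by (rule result_best_timed_in)
  then obtain i where "i \<in> set [1..<Suc a]"
    and "result (best_timed ?cs) = result (solve_color solve x i)"
    unfolding set_map by blast
  then have i: "i \<in> {1..a}"
    and best: "result (best_timed ?cs) = (color_value i, map (\<lambda>v. (v, snd (out v))) (color_class i))"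
    by (auto simp: result_solve_color simp del: upt_Suc)
  have "color_value j \<le> color_value i" if "j \<in> {1..a}" for j
    using result_best_timed_max[of "result (solve_color solve x j)" ?cs] that
    unfolding best by (auto simp: result_solve_color simp del: upt_Suc)
  moreover have "result (algorithm_C solve x)
      = (color_value i, concat (map (\<lambda>v. copies v (snd (out v))) (color_class i)))"
    unfolding algorithm_C_def using best
    by (simp add: instance_props(7) case_prod_unfold comp_def del: upt_Suc)
  ultimately show ?thesis
    using i best that by blast
qed

section \<open>The approximation ratio by double counting\<close>

lemma b_opt_le_sum_color_value: "b * opt (inst x) \<le> (\<Sum>i=1..a. color_value i)"
proof -
  have "b * opt (inst x) \<le> b * (\<Sum>v\<in>V. fst (out v))"
    by (intro mult_left_mono order_trans[OF opt_le_sum_opt_nodes[OF instance_props(1,2)]]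
        sum_mono out_props(3)) auto
  \<comment> \<open>The factor \<open>b\<close> becomes a sum over the colors of \<open>v\<close>;
    selecting these from \<open>{1..a}\<close> lets the two sums be exchanged afterwards.\<close>
  also have "\<dots> = (\<Sum>v\<in>V. \<Sum>i | i \<in> {1..a} \<and> i \<in> color_set x v. fst (out v))"
    unfolding sum_distrib_left
  proof (intro sum.cong refl)
    fix v
    assume "v \<in> V"
    then have "{i \<in> {1..a}. i \<in> color_set x v} = color_set x v" "card (color_set x v) = b"
      using color_set_props by blast+
    then show "b * fst (out v) = (\<Sum>i | i \<in> {1..a} \<and> i \<in> color_set x v. fst (out v))"
      by simp
  qed
  also have "\<dots> = (\<Sum>i=1..a. \<Sum>v | v \<in> V \<and> i \<in> color_set x v. fst (out v))"
    by (rule sum.swap_restrict) auto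
  also have "\<dots> = (\<Sum>i=1..a. color_value i)"
    unfolding color_value_def
    by (simp add: sum_list_distinct_conv_sum_set[OF distinct_color_class] set_color_class)
  finally show ?thesis .
qed

lemma correct:
  "case result (algorithm_C solve x) of (value, xs) \<Rightarrow>
     feasible_schedule (inst x) xs \<and>
     value = objective (inst x) (assignment xs) \<and>
     real (objective (inst x) (assignment xs)) \<ge> 1 / (real a / real b) * real (opt (inst x))"
proof -
  obtain i where i: "i \<in> {1..a}" "\<And>j. j \<in> {1..a} \<Longrightarrow> color_value j \<le> color_value i"
    and res: "result (algorithm_C solve x)
      = (color_value i, concat (map (\<lambda>v. copies v (snd (out v))) (color_class i)))"
    using result_algorithm_C by blast
  have disj: "u \<inter> v = {}" if "u \<in> set (color_class i)" "v \<in> set (color_class i)" "u \<noteq> v" for u v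
    using that same_color_disjoint by (auto simp: set_color_class)
  have feas: "feasible_schedule (node_problem (inst x) v) (snd (out v))"
    if "v \<in> set (color_class i)" for v
    using that out_props(1) by (auto simp: set_color_class)
  have sub: "set (color_class i) \<subseteq> V"
    by (auto simp: set_color_class)
  note combined = combined_schedule[OF instance_props(1,3,4) distinct_color_class sub disj feas]
  have "color_value i = (\<Sum>v\<leftarrow>color_class i.
      objective (node_problem (inst x) v) (assignment (snd (out v))))"
    unfolding color_value_def using sub out_props(2)
    by (intro arg_cong[of _ _ sum_list] map_cong) auto
  \<comment> \<open>The largest of \<open>a\<close> values is at least their average.\<close>
  moreover have "b * opt (inst x) \<le> a * color_value i"
  proof -
    have "(\<Sum>j=1..a. color_value j) \<le> of_nat (card {1..a}) * color_value i"
      using i(2) by (intro sum_bounded_above)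
    then show ?thesis
      using b_opt_le_sum_color_value by simp
  qed
  then have "real b * real (opt (inst x)) \<le> real a * real (color_value i)"
    by (metis of_nat_le_iff of_nat_mult)
  then have "1 / (real a / real b) * real (opt (inst x)) \<le> real (color_value i)"
    using b_pos b_le by (simp add: field_simps)
  ultimately show ?thesis
    using combined unfolding res by simp
qed

section \<open>Polynomial bounds on time and output\<close>

text \<open>One number dominating the sizes in the input as well as time and output of the solver on
  every node problem. A sum instead of a maximum keeps it a polynomial in the input size.\<close>

definition M :: nat where
  "M = input_size x + poly q (input_size x)"

lemma size_bounds:
  "instance_size (inst x) \<le> M" "a \<le> M" "length (nodes x) \<le> M"
  "v \<in> V \<Longrightarrow> card v \<le> M" "v \<in> V \<Longrightarrow> card (color_set x v) \<le> M"
proof -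
  have "(\<Sum>v\<leftarrow>nodes x. 1) \<le> (\<Sum>v\<leftarrow>nodes x. 1 + card v + card (color_set x v))"
    by (intro sum_list_mono) simp
  then show "instance_size (inst x) \<le> M" "a \<le> M" "length (nodes x) \<le> M"
    by (simp_all add: M_def input_size_def instance_props(7) sum_list_triv)
  assume "v \<in> V"
  then have "1 + card v + card (color_set x v)
      \<le> (\<Sum>v\<leftarrow>nodes x. 1 + card v + card (color_set x v))"
    by (intro member_le_sum_list) (auto simp: instance_props(6))
  then show "card v \<le> M" "card (color_set x v) \<le> M"
    by (simp_all add: M_def input_size_def)
qed

lemma length_color_class: "length (color_class i) \<le> M"
  using size_bounds(3) length_filter_le[of _ "nodes x"] unfolding color_class_def
  by (rule order_trans[rotated])

text \<open>A node problem is no larger than the whole input, and \<open>q\<close> is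
  monotone.\<close>

lemma solve_bounds:
  assumes "v \<in> V"
  shows "steps (solve (node_problem (inst x) v)) \<le> M" "outcome_size (out v) \<le> M"
proof -
  let ?J = "node_problem (inst x) v"
  have "instance_size ?J \<le> input_size x"
    using instance_size_node_problem_le[OF instance_props(1) assms] by (simp add: input_size_def)
  then have "poly q (instance_size ?J) \<le> M"
    using poly_nat_mono[of "instance_size ?J" "input_size x" q] by (simp add: M_def)
  moreover have "steps (solve ?J) \<le> poly q (instance_size ?J)"
    "outcome_size (out v) \<le> poly q (instance_size ?J)"
    using solver node_problem_single_type[OF instance_props(1) assms]
    by (auto simp: approximation_algorithm_def out_def)
  ultimately show "steps (solve ?J) \<le> M" "outcome_size (out v) \<le> M"
    by linarith+
qed

lemma bits_out_le: "v \<in> V \<Longrightarrow> bits (fst (out v)) \<le> M"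
  using solve_bounds(2)[of v] by (simp add: outcome_size_def)

lemma bits_color_value_le: "bits (color_value i) \<le> M * (1 + M)"
  unfolding color_value_def using length_color_class
  by (intro bits_sum_list_le) (auto simp: set_color_class intro: bits_out_le)

lemma steps_solve_color_le: "steps (solve_color solve x i) \<le> color_bound M"
proof -
  let ?F = "filter_timed (\<lambda>v. charge (1 + card (color_set x v)) (i \<in> color_set x v)) (nodes x)"
  let ?f = "\<lambda>v. bind_timed (build_node_instance (inst x) v)
    (\<lambda>J. bind_timed (solve J) (\<lambda>(C, xs). charge 1 (C, v, xs)))"
  have F: "result ?F = color_class i"
    by (simp add: color_class_def)
  have outs: "map fst (result (map_timed ?f (color_class i))) = map (\<lambda>v. fst (out v)) (color_class i)"
    by (simp add: out_def case_prod_unfold)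
  have "steps ?F \<le> 1 + M * (1 + (1 + M))"
    using size_bounds(3,5) by (intro steps_filter_timed_le) (auto simp: instance_props(6))
  moreover have "steps (map_timed ?f (color_class i)) \<le> 1 + M * (1 + (build_bound M + M + 1))"
  proof (rule steps_map_timed_le[OF length_color_class])
    fix v
    assume "v \<in> set (color_class i)"
    then have v: "v \<in> V"
      by (simp add: set_color_class)
    show "steps (?f v) \<le> build_bound M + M + 1"
      using steps_build_node_instance_le[OF instance_props(1) v size_bounds(1)] solve_bounds(1)[OF v]
      by (simp add: case_prod_unfold)
  qed
  moreover have "steps (sum_timed (map (\<lambda>v. fst (out v)) (color_class i)))
      \<le> 1 + M * (1 + M + M * (1 + M))"
    using length_color_class
    by (intro steps_sum_timed_le) (auto simp: set_color_class intro: bits_out_le)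
  moreover have "length (result (map_timed ?f (color_class i))) \<le> M"
    using length_color_class by simp
  ultimately show ?thesis
    unfolding solve_color_def bind_timed_simps F outs charge_simps color_bound_def by linarith
qed

lemma resource_bounds:
  "steps (algorithm_C solve x) \<le> total_bound M"
  "outcome_size (result (algorithm_C solve x)) \<le> total_bound M"
proof -
  obtain i where res: "result (algorithm_C solve x)
      = (color_value i, concat (map (\<lambda>v. copies v (snd (out v))) (color_class i)))"
    and best: "result (best_timed (map (\<lambda>i. result (solve_color solve x i)) [1..<Suc a]))
      = (color_value i, map (\<lambda>v. (v, snd (out v))) (color_class i))"
    using result_algorithm_C by blast
  have out_size: "length (snd (out v)) \<le> M" "card v \<le> M" "(\<Sum>e\<leftarrow>snd (out v). entry_size e) \<le> M"
    "\<And>e. e \<in> set (snd (out v)) \<Longrightarrow> entry_size e \<le> M"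
    if "v \<in> set (color_class i)" for v
  proof -
    have v: "v \<in> V"
      using that by (simp add: set_color_class)
    show "card v \<le> M"
      using size_bounds(4)[OF v] .
    show "length (snd (out v)) \<le> M" "\<And>e. e \<in> set (snd (out v)) \<Longrightarrow> entry_size e \<le> M"
      using entries_le_outcome_size[where out = "out v"] solve_bounds(2)[OF v] order_trans by blast+
    show "(\<Sum>e\<leftarrow>snd (out v). entry_size e) \<le> M"
      using solve_bounds(2)[OF v] by (simp add: outcome_size_def)
  qed
  let ?copy = "\<lambda>(v, xs). copy_to_types v xs"
  let ?parts = "map (\<lambda>v. (v, snd (out v))) (color_class i)"
  have colors: "steps (map_timed (solve_color solve x) [1..<Suc a]) \<le> 1 + M * (1 + color_bound M)"
    using size_bounds(2) by (intro steps_map_timed_le steps_solve_color_le) auto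
  \<comment> \<open>The compared values are sums over color classes, hence their length
    \<open>M * (1 + M)\<close>.\<close>
  have choice: "steps (best_timed (map (\<lambda>i. result (solve_color solve x i)) [1..<Suc a]))
      \<le> 1 + M * (1 + 2 * (M * (1 + M)))"
    using size_bounds(2) bits_color_value_le
    by (intro steps_best_timed_le) (auto simp: result_solve_color)
  have copying: "steps (map_timed ?copy ?parts) \<le> 1 + M * (1 + copy_bound M)"
    using length_color_class out_size
    by (intro steps_map_timed_le) (auto intro!: steps_copy_to_types_le)
  have concat: "steps (concat_timed (map (\<lambda>p. result (?copy p)) ?parts)) \<le> 1 + M * (1 + M * M)"
    using length_color_class out_size
    by (intro steps_concat_timed_le) (auto simp: length_copies intro!: mult_le_mono)
  show "steps (algorithm_C solve x) \<le> total_bound M"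
    using colors choice copying concat bits_color_value_le[of i] size_bounds(2)
    unfolding algorithm_C_def bind_timed_simps charge_simps instance_props(7) result_map_timed
      best prod.case total_bound_def
    by linarith
  have "(\<Sum>e\<leftarrow>concat (map (\<lambda>v. copies v (snd (out v))) (color_class i)). entry_size e)
      = (\<Sum>v\<leftarrow>color_class i. card v * (\<Sum>e\<leftarrow>snd (out v). entry_size e))"
    by (simp add: sum_list_map_concat comp_def sum_entry_size_copies)
  \<comment> \<open>At most \<open>M\<close> nodes, each with at most \<open>M\<close> types and a
    schedule of size at most \<open>M\<close>.\<close>
  also have "\<dots> \<le> M * (M * M)"
    using length_color_class out_size by (intro sum_list_map_le mult_le_mono) auto
  finally show "outcome_size (result (algorithm_C solve x)) \<le> total_bound M"
    using bits_color_value_le[of i]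
    unfolding res outcome_size_def total_bound_def fst_conv snd_conv by linarith
qed

end

theorem theorem10:
  fixes solve :: "('d, 'l) mrmd \<Rightarrow> ('d, 'l) outcome timed"
  assumes "exact_single_type_solver solve"
  shows "\<exists>p. \<forall>a b. 0 < b \<and> b \<le> a \<longrightarrow>
           approximation_algorithm p (real a / real b) (colored_same_start_inputs a b)
             inst input_size (algorithm_C solve)"
proof -
  obtain q where q: "approximation_algorithm q 1 single_type_instances (\<lambda>I. I) instance_size solve"
    using assms by (auto simp: exact_single_type_solver_def)
  \<comment> \<open>\<open>[:0, 1:]\<close> is the identity, so \<open>[:0, 1:] + q\<close>
    evaluates to \<open>M\<close>. As \<open>q\<close> is fixed before \<open>a\<close> and
    \<open>b\<close>, the same \<open>p\<close> serves for all of them.\<close>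
  define p where "p = total_bound ([:0, 1:] + q)"
  have "approximation_algorithm p (real a / real b) (colored_same_start_inputs a b)
      inst input_size (algorithm_C solve)" if "0 < b" "b \<le> a" for a b
  proof -
    have run: "coloring_run solve q x a b" if "x \<in> colored_same_start_inputs a b" for x
      using q that \<open>0 < b\<close> \<open>b \<le> a\<close> by unfold_locales
    show ?thesis
      unfolding approximation_algorithm_def
    proof (intro conjI ballI)
      show "1 \<le> real a / real b"
        using \<open>0 < b\<close> \<open>b \<le> a\<close> by simp
    next
      fix x :: "('d, 'l) colored_input"
      assume x: "x \<in> colored_same_start_inputs a b"
      interpret coloring_run solve q x a b
        by (rule run[OF x])
      have "poly p (input_size x) = total_bound M"
        by (simp add: p_def poly_total_bound M_def)
      then show "steps (algorithm_C solve x) \<le> poly p (input_size x)"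
        "outcome_size (result (algorithm_C solve x)) \<le> poly p (input_size x)"
        using resource_bounds by simp_all
      show "case result (algorithm_C solve x) of (value, xs) \<Rightarrow>
          feasible_schedule (inst x) xs \<and>
          value = objective (inst x) (assignment xs) \<and>
          real (objective (inst x) (assignment xs)) \<ge> 1 / (real a / real b) * real (opt (inst x))"
        by (rule correct)
    qed
  qed
  then show ?thesis by blast
qed

end
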